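(* Let $(\Omega,\Sigma,\mu)$ and $(\Omega,\Sigma,\nu)$ be two $\sigma$-finite measure spaces, let $p,q\in[1,+\infty]$, and let $g\in L_0(\Omega,\mu)$ be such that the multiplication operator $M_g:L_p(\Omega,\mu)\to L_q(\Omega,\nu)$, $f\mapsto g\cdot f$, is a well-defined bounded operator. Let $\Omega=\Omega_c\sqcup\Omega_s$ be the partition from the Lebesgue decomposition of $\nu$ with respect to $\mu$. Then the following are equivalent: i) $M_g\in\mathcal{B}(L_p(\Omega,\mu),L_q(\Omega,\nu))$ is topologically injective; ii) $M_{\chi_{\Omega_c}/g}$ is a well-defined bounded operator in $\mathcal{B}(L_q(\Omega,\nu),L_p(\Omega,\mu))$, it is a left inverse of $M_g$ (that is, $M_{\chi_{\Omega_c}/g}M_g=1_{L_p(\Omega,\mu)}$), and it is topologically surjective.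
   Context: All linear spaces are over $\mathbb{C}$; measures are nonnegative, $\sigma$-additive, with values in $[0,+\infty]$. $L_0(\Omega,\mu)$ is the space of measurable complex functions on $\Omega$. Lebesgue decomposition of $\nu$ with respect to $\mu$: a nonnegative measurable function $\rho_{\nu,\mu}$, a $\sigma$-finite measure $\nu_s$ and a set $\Omega_s\in\Sigma$ such that $\nu=\rho_{\nu,\mu}\cdot\mu+\nu_s$ and $\mu(\Omega_s)=\nu_s(\Omega_c)=0$, where $\Omega_c=\Omega\setminus\Omega_s$ and $(\rho\cdot\mu)(E)=\int_E\rho\,d\mu$. $M_h$ denotes multiplication by the measurable function $h$. $\chi_{\Omega_c}$ is the indicator function of $\Omega_c$; $\chi_{\Omega_c}/g$ is the function equal to $1/g$ on $\Omega_c$ and $0$ elsewhere (with value $0$ also at points where $g=0$). A bounded operator $T:X\to Y$ between normed spaces is topologically injective if there is $c>0$ with $\|T(x)\|\geq c\|x\|$ for all $x\in X$; it is topologically surjective if there is $c>0$ such that for every $y\in Y$ there is $x\in X$ with $T(x)=y$ and $\|x\|\leq c\|y\|$. *)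

theory Defs
  imports "HOL-Probability.Essential_Supremum"
begin

section \<open>Complex normed spaces with explicit carrier\<close>

text \<open>The spaces \<open>L_p\<close> depend on a measure and an exponent that are variables of the statement, so
  normed spaces are records with a carrier; only the operations on the carrier matter.\<close>

record 'v nspace =
  vcarrier :: "'v set"
  vadd :: "'v \<Rightarrow> 'v \<Rightarrow> 'v"
  vscale :: "complex \<Rightarrow> 'v \<Rightarrow> 'v"
  vnorm :: "'v \<Rightarrow> real"

definition bounded_ops :: "'v nspace \<Rightarrow> 'w nspace \<Rightarrow> ('v \<Rightarrow> 'w) set" where
  "bounded_ops X Y = {T.
     (\<forall>x\<in>vcarrier X. T x \<in> vcarrier Y) \<and>
     (\<forall>x\<in>vcarrier X. \<forall>y\<in>vcarrier X. T (vadd X x y) = vadd Y (T x) (T y)) \<and>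
     (\<forall>c. \<forall>x\<in>vcarrier X. T (vscale X c x) = vscale Y c (T x)) \<and>
     (\<exists>C. \<forall>x\<in>vcarrier X. vnorm Y (T x) \<le> C * vnorm X x)}"

definition topologically_injective :: "'v nspace \<Rightarrow> 'w nspace \<Rightarrow> ('v \<Rightarrow> 'w) \<Rightarrow> bool" where
  "topologically_injective X Y T \<longleftrightarrow> (\<exists>c>0. \<forall>x\<in>vcarrier X. vnorm Y (T x) \<ge> c * vnorm X x)"

definition topologically_surjective :: "'v nspace \<Rightarrow> 'w nspace \<Rightarrow> ('v \<Rightarrow> 'w) \<Rightarrow> bool" where
  "topologically_surjective X Y T \<longleftrightarrow>
     (\<exists>c>0. \<forall>y\<in>vcarrier Y. \<exists>x\<in>vcarrier X. T x = y \<and> vnorm X x \<le> c * vnorm Y y)"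


section \<open>Spaces \<open>L_p\<close> of almost-everywhere classes\<close>

definition ae_rel :: "'a measure \<Rightarrow> (('a \<Rightarrow> complex) \<times> ('a \<Rightarrow> complex)) set" where
  "ae_rel M = {(f, g). f \<in> borel_measurable M \<and> g \<in> borel_measurable M \<and> (AE x in M. f x = g x)}"

definition ae_class :: "'a measure \<Rightarrow> ('a \<Rightarrow> complex) \<Rightarrow> ('a \<Rightarrow> complex) set" where
  "ae_class M f = ae_rel M `` {f}"

text \<open>The extended \<open>p\<close>-norm of a function. For finite \<open>p\<close> it is the \<open>p\<close>-th root of
  \<open>\<integral> \<bar>f\<bar>\<^sup>p\<close>; the library has no real powers on \<^typ>\<open>ennreal\<close>, so the infinite value
  is treated separately.\<close>

definition Lp_enorm :: "ennreal \<Rightarrow> 'a measure \<Rightarrow> ('a \<Rightarrow> complex) \<Rightarrow> ennreal" where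
  "Lp_enorm p M f =
     (if p = \<infinity> then esssup M (\<lambda>x. ennreal (cmod (f x)))
      else let I = (\<integral>\<^sup>+x. ennreal (cmod (f x) powr enn2real p) \<partial>M)
           in if I = \<infinity> then \<infinity> else ennreal (enn2real I powr (1 / enn2real p)))"

definition Lp_funs :: "ennreal \<Rightarrow> 'a measure \<Rightarrow> ('a \<Rightarrow> complex) set" where
  "Lp_funs p M = {f \<in> borel_measurable M. Lp_enorm p M f < \<infinity>}"

text \<open>The operations are defined through representatives; see the lemmas below.\<close>

definition Lp :: "ennreal \<Rightarrow> 'a measure \<Rightarrow> ('a \<Rightarrow> complex) set nspace" where
  "Lp p M = \<lparr>
     vcarrier = Lp_funs p M // ae_rel M,
     vadd = (\<lambda>F G. \<Union>f\<in>F. \<Union>g\<in>G. ae_class M (\<lambda>x. f x + g x)),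
     vscale = (\<lambda>c F. \<Union>f\<in>F. ae_class M (\<lambda>x. c * f x)),
     vnorm = (\<lambda>F. the_elem ((\<lambda>f. enn2real (Lp_enorm p M f)) ` F))\<rparr>"


section \<open>Multiplication operators\<close>

text \<open>Multiplication by \<open>h\<close> as a map into classes modulo \<open>N\<close>-almost everywhere equality. If the
  classes of the argument are taken modulo another measure \<open>M\<close>, this is meaningful only
  if the class of the product does not depend on the representative, which is part of
  \<open>mult_op_well_defined\<close>.\<close>

definition mult_op :: "'a measure \<Rightarrow> ('a \<Rightarrow> complex) \<Rightarrow> ('a \<Rightarrow> complex) set \<Rightarrow> ('a \<Rightarrow> complex) set" where
  "mult_op N h F = (\<Union>f\<in>F. ae_class N (\<lambda>x. h x * f x))"

definition mult_op_well_defined ::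
  "ennreal \<Rightarrow> 'a measure \<Rightarrow> ennreal \<Rightarrow> 'a measure \<Rightarrow> ('a \<Rightarrow> complex) \<Rightarrow> bool" where
  "mult_op_well_defined p M q N h \<longleftrightarrow>
     (\<forall>f\<in>Lp_funs p M. (\<lambda>x. h x * f x) \<in> Lp_funs q N) \<and>
     (\<forall>f\<in>Lp_funs p M. \<forall>f'\<in>Lp_funs p M. (AE x in M. f x = f' x) \<longrightarrow>
        (AE x in N. h x * f x = h x * f' x))"


section \<open>Lebesgue decomposition\<close>

text \<open>\<open>\<nu> = \<rho> \<cdot> \<mu> + \<nu>\<^sub>s\<close> with \<open>\<mu>\<close> and \<open>\<nu>\<^sub>s\<close> concentrated on the complement of
  \<open>\<Omega>\<^sub>s\<close> and on \<open>\<Omega>\<^sub>s\<close>, respectively.\<close>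

definition lebesgue_decomposition ::
  "'a measure \<Rightarrow> 'a measure \<Rightarrow> ('a \<Rightarrow> real) \<Rightarrow> 'a measure \<Rightarrow> 'a set \<Rightarrow> bool" where
  "lebesgue_decomposition \<mu> \<nu> \<rho> \<nu>s \<Omega>s \<longleftrightarrow>
     \<rho> \<in> borel_measurable \<mu> \<and> (\<forall>x\<in>space \<mu>. 0 \<le> \<rho> x) \<and>
     sets \<nu>s = sets \<mu> \<and> sigma_finite_measure \<nu>s \<and> \<Omega>s \<in> sets \<mu> \<and>
     (\<forall>E\<in>sets \<mu>. emeasure \<nu> E = emeasure (density \<mu> (\<lambda>x. ennreal (\<rho> x))) E + emeasure \<nu>s E) \<and>
     emeasure \<mu> \<Omega>s = 0 \<and> emeasure \<nu>s (space \<mu> - \<Omega>s) = 0"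


section \<open>The operations act on representatives as expected\<close>

lemma equiv_ae_rel: "equiv (borel_measurable M) (ae_rel M)"
proof (rule equivI)
  show "ae_rel M \<subseteq> borel_measurable M \<times> borel_measurable M"
    unfolding ae_rel_def by blast
  show "refl_on (borel_measurable M) (ae_rel M)"
    by (auto simp: refl_on_def ae_rel_def)
  show "sym (ae_rel M)"
    by (auto simp: sym_def ae_rel_def eq_commute)
  show "trans (ae_rel M)"
  proof (rule transI)
    fix f g h assume fg: "(f, g) \<in> ae_rel M" and gh: "(g, h) \<in> ae_rel M"
    have "AE x in M. f x = g x" "AE x in M. g x = h x"
      using fg gh by (simp_all add: ae_rel_def)
    then have "AE x in M. f x = h x" by eventually_elim simp
    then show "(f, h) \<in> ae_rel M" using fg gh by (simp add: ae_rel_def)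
  qed
qed

lemma mem_ae_class:
  "g \<in> ae_class M f \<longleftrightarrow>
    f \<in> borel_measurable M \<and> g \<in> borel_measurable M \<and> (AE x in M. f x = g x)"
  by (auto simp: ae_class_def ae_rel_def)

lemma ae_class_self: "f \<in> borel_measurable M \<Longrightarrow> f \<in> ae_class M f"
  by (simp add: mem_ae_class)

lemma ae_class_eq_iff:
  assumes "f \<in> borel_measurable M" "g \<in> borel_measurable M"
  shows "ae_class M f = ae_class M g \<longleftrightarrow> (AE x in M. f x = g x)"
  using eq_equiv_class_iff[OF equiv_ae_rel assms] assms by (simp add: ae_class_def ae_rel_def)

lemma Lp_carrier: "vcarrier (Lp p M) = ae_class M ` Lp_funs p M"
  by (auto simp: Lp_def quotient_def ae_class_def)

lemma Lp_enorm_cong_AE: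
  assumes "f \<in> borel_measurable M" "g \<in> borel_measurable M" "AE x in M. f x = g x"
  shows "Lp_enorm p M f = Lp_enorm p M g"
proof -
  have "esssup M (\<lambda>x. ennreal (cmod (f x))) = esssup M (\<lambda>x. ennreal (cmod (g x)))"
  proof (rule esssup_AE_cong)
    show "AE x in M. ennreal (cmod (f x)) = ennreal (cmod (g x))"
      using assms(3) by eventually_elim simp
  qed (use assms in measurable)
  moreover have "(\<integral>\<^sup>+x. ennreal (cmod (f x) powr enn2real p) \<partial>M)
      = (\<integral>\<^sup>+x. ennreal (cmod (g x) powr enn2real p) \<partial>M)"
  proof (rule nn_integral_cong_AE)
    show "AE x in M. ennreal (cmod (f x) powr enn2real p) = ennreal (cmod (g x) powr enn2real p)"
      using assms(3) by eventually_elim simp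
  qed
  ultimately show ?thesis by (simp add: Lp_enorm_def)
qed

lemma Lp_norm_class:
  assumes "f \<in> borel_measurable M"
  shows "vnorm (Lp p M) (ae_class M f) = enn2real (Lp_enorm p M f)"
proof -
  have "Lp_enorm p M g = Lp_enorm p M f" if "g \<in> ae_class M f" for g
    using that Lp_enorm_cong_AE[of f M g p] by (simp add: mem_ae_class)
  then have "(\<lambda>f. enn2real (Lp_enorm p M f)) ` ae_class M f
      = (\<lambda>_. enn2real (Lp_enorm p M f)) ` ae_class M f"
    by (intro image_cong) simp_all
  also have "\<dots> = {enn2real (Lp_enorm p M f)}"
    using ae_class_self[OF assms] by (intro image_constant)
  finally have "(\<lambda>f. enn2real (Lp_enorm p M f)) ` ae_class M f = {enn2real (Lp_enorm p M f)}" .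
  then show ?thesis by (simp add: Lp_def)
qed

lemma Lp_add_class:
  assumes f: "f \<in> borel_measurable M" and g: "g \<in> borel_measurable M"
  shows "vadd (Lp p M) (ae_class M f) (ae_class M g) = ae_class M (\<lambda>x. f x + g x)"
proof -
  have "ae_class M (\<lambda>x. f' x + g' x) = ae_class M (\<lambda>x. f x + g x)"
    if f': "f' \<in> ae_class M f" and g': "g' \<in> ae_class M g" for f' g'
  proof -
    have m: "f' \<in> borel_measurable M" "g' \<in> borel_measurable M"
      and ae: "AE x in M. f x = f' x" "AE x in M. g x = g' x"
      using f' g' by (simp_all add: mem_ae_class)
    from ae have "AE x in M. f' x + g' x = f x + g x" by eventually_elim simp
    then show ?thesis using f g m by (subst ae_class_eq_iff) simp_all
  qed
  then have "(\<Union>f'\<in>ae_class M f. \<Union>g'\<in>ae_class M g. ae_class M (\<lambda>x. f' x + g' x))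
      = ae_class M (\<lambda>x. f x + g x)"
    using ae_class_self[OF f] ae_class_self[OF g] by blast
  then show ?thesis by (simp add: Lp_def)
qed

lemma Lp_scale_class:
  assumes f: "f \<in> borel_measurable M"
  shows "vscale (Lp p M) c (ae_class M f) = ae_class M (\<lambda>x. c * f x)"
proof -
  have "ae_class M (\<lambda>x. c * f' x) = ae_class M (\<lambda>x. c * f x)" if f': "f' \<in> ae_class M f" for f'
  proof -
    have m: "f' \<in> borel_measurable M" and ae: "AE x in M. f x = f' x"
      using f' by (simp_all add: mem_ae_class)
    from ae have "AE x in M. c * f' x = c * f x" by eventually_elim simp
    then show ?thesis using f m by (subst ae_class_eq_iff) simp_all
  qed
  then have "(\<Union>f'\<in>ae_class M f. ae_class M (\<lambda>x. c * f' x)) = ae_class M (\<lambda>x. c * f x)"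
    using ae_class_self[OF f] by blast
  then show ?thesis by (simp add: Lp_def)
qed

lemma mult_op_class:
  assumes wd: "mult_op_well_defined p M q N h" and f: "f \<in> Lp_funs p M"
  shows "mult_op N h (ae_class M f) = ae_class N (\<lambda>x. h x * f x)"
proof -
  have "ae_class N (\<lambda>x. h x * f' x) = ae_class N (\<lambda>x. h x * f x)" if f': "f' \<in> ae_class M f" for f'
  proof -
    have L: "f' \<in> Lp_funs p M"
      using f f' Lp_enorm_cong_AE[of f M f' p] by (simp add: Lp_funs_def mem_ae_class)
    have ae: "AE x in M. f' x = f x"
      using f' by (simp add: mem_ae_class eq_commute)
    have "AE x in N. h x * f' x = h x * f x"
      using wd f L ae unfolding mult_op_well_defined_def by blast
    moreover have "(\<lambda>x. h x * f' x) \<in> Lp_funs q N" "(\<lambda>x. h x * f x) \<in> Lp_funs q N"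
      using wd f L unfolding mult_op_well_defined_def by blast+
    ultimately show ?thesis
      by (subst ae_class_eq_iff) (auto simp: Lp_funs_def)
  qed
  moreover have "f \<in> ae_class M f"
    using f by (simp add: Lp_funs_def ae_class_self)
  ultimately show ?thesis unfolding mult_op_def by blast
qed

end

theory Submission
  imports Defs
begin

text \<open>
  The bound \<open>c \<parallel>f\<parallel> \<le> \<parallel>g f\<parallel>\<close> that expresses topological injectivity is a priori known only for
  \<open>f\<close> in \<open>L\<^sub>p(\<mu>)\<close>. The whole proof rests on the fact that it extends to every measurable \<open>f\<close>
  with \<open>g f\<close> in \<open>L\<^sub>q(\<nu>)\<close> (\<open>lower_bound_extends\<close>): by \<open>\<sigma>\<close>-finiteness \<open>f\<close> is the increasing limit of
  its restrictions to sets \<open>E\<^sub>n\<close> of finite measure on which it is bounded, the bound holds for each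
  restriction, cutting down to \<open>E\<^sub>n\<close> does not increase \<open>\<parallel>g f\<parallel>\<close>, and the \<open>p\<close>-norm is continuous along
  such limits (\<open>Lp_enorm_le_exhaustion\<close>). This argument treats all pairs of exponents alike.

  The extended bound is then used three times. For \<open>f = \<chi>\<^sub>A\<close> with \<open>\<nu>(A) = 0\<close> it shows that \<open>\<mu>\<close>
  is absolutely continuous with respect to \<open>\<nu>\<close>, so that multiplication by \<open>\<chi>\<^sub>c/g\<close> respects
  classes (here \<open>\<chi>\<^sub>c\<close> is the indicator of \<open>\<Omega>\<^sub>c\<close>). For \<open>f = \<chi>\<^sub>A\<close> with \<open>A = {g = 0}\<close> it
  shows that \<open>g\<close> vanishes almost nowhere for \<open>\<mu>\<close>; as \<open>\<mu>(\<Omega>\<^sub>s) = 0\<close>, the product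
  \<open>(\<chi>\<^sub>c/g) g\<close> is \<open>1\<close> \<open>\<mu>\<close>-almost everywhere, which gives the left inverse. For
  \<open>f = (\<chi>\<^sub>c/g) u\<close> with \<open>u\<close> in \<open>L\<^sub>q(\<nu>)\<close> one has \<open>\<bar>g f\<bar> \<le> \<bar>u\<bar>\<close>, and the bound says that multiplication by
  \<open>\<chi>\<^sub>c/g\<close> maps \<open>L\<^sub>q(\<nu>)\<close> boundedly into \<open>L\<^sub>p(\<mu>)\<close>. An operator with a bounded right inverse is
  topologically surjective, and one with a bounded left inverse is topologically
  injective; the second of these also gives the converse implication.
\<close>

section \<open>Order and limit properties of the extended norm\<close>

text \<open>Describing the norm by its sublevel sets removes the \<open>p\<close>-th root and the separate infinite value;
  the conditions that remain are stable under monotone limits. At \<open>K = 0\<close> it says that \<open>f\<close> vanishes almost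
  everywhere.\<close>

lemma Lp_enorm_le_iff:
  assumes f: "f \<in> borel_measurable M" and p: "0 < p" and K: "0 \<le> K"
  shows "Lp_enorm p M f \<le> ennreal K \<longleftrightarrow>
    (if p = \<infinity> then AE x in M. cmod (f x) \<le> K
     else (\<integral>\<^sup>+x. ennreal (cmod (f x) powr enn2real p) \<partial>M) \<le> ennreal (K powr enn2real p))"
proof (cases "p = \<infinity>")
  case True
  have "esssup M (\<lambda>x. ennreal (cmod (f x))) \<le> ennreal K \<longleftrightarrow> (AE x in M. cmod (f x) \<le> K)"
  proof
    assume le: "esssup M (\<lambda>x. ennreal (cmod (f x))) \<le> ennreal K"
    have "AE x in M. ennreal (cmod (f x)) \<le> esssup M (\<lambda>x. ennreal (cmod (f x)))"
      by (rule esssup_AE)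
    then show "AE x in M. cmod (f x) \<le> K"
    proof eventually_elim
      case (elim x)
      then show ?case using le K ennreal_le_iff order_trans by blast
    qed
  next
    assume "AE x in M. cmod (f x) \<le> K"
    then have "AE x in M. ennreal (cmod (f x)) \<le> ennreal K"
      by eventually_elim (simp add: ennreal_leI)
    then show "esssup M (\<lambda>x. ennreal (cmod (f x))) \<le> ennreal K"
      using f by (intro esssup_I) simp_all
  qed
  with True show ?thesis by (simp add: Lp_enorm_def)
next
  case False
  define r where "r = enn2real p"
  have r: "0 < r" using p False by (simp add: r_def enn2real_positive_iff less_top)
  define I where "I = (\<integral>\<^sup>+x. ennreal (cmod (f x) powr r) \<partial>M)"
  have norm: "Lp_enorm p M f = (if I = \<infinity> then \<infinity> else ennreal (enn2real I powr (1 / r)))"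
    using False by (simp add: Lp_enorm_def I_def r_def Let_def)
  have "Lp_enorm p M f \<le> ennreal K \<longleftrightarrow> I \<le> ennreal (K powr r)"
  proof (cases "I = \<infinity>")
    case True
    then show ?thesis by (simp add: norm top_unique)
  next
    case I: False
    then obtain i where i: "I = ennreal i" "0 \<le> i" by (cases I) auto
    have "i powr (1 / r) \<le> K \<longleftrightarrow> i \<le> K powr r"
    proof
      assume "i powr (1 / r) \<le> K"
      then have "(i powr (1 / r)) powr r \<le> K powr r" using r by (intro powr_mono2) simp_all
      then show "i \<le> K powr r" using r i by (simp add: powr_powr)
    next
      assume "i \<le> K powr r"
      then have "i powr (1 / r) \<le> (K powr r) powr (1 / r)" using r i by (intro powr_mono2) simp_all
      then show "i powr (1 / r) \<le> K" using r K by (simp add: powr_powr)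
    qed
    then show ?thesis using i K by (simp add: norm)
  qed
  then show ?thesis using False by (simp add: I_def r_def)
qed

lemma Lp_enorm_le_mono:
  assumes f: "f \<in> borel_measurable M" and g: "g \<in> borel_measurable M"
    and p: "0 < p" and K: "0 \<le> K"
    and le: "\<And>x. x \<in> space M \<Longrightarrow> cmod (f x) \<le> cmod (g x)"
    and gK: "Lp_enorm p M g \<le> ennreal K"
  shows "Lp_enorm p M f \<le> ennreal K"
proof (cases "p = \<infinity>")
  case True
  then have "AE x in M. cmod (g x) \<le> K"
    using gK Lp_enorm_le_iff[OF g p K] by simp
  then have "AE x in M. cmod (f x) \<le> K"
    using AE_space by eventually_elim (use le order_trans in blast)
  then show ?thesis using True Lp_enorm_le_iff[OF f p K] by simp
next
  case False
  have "(\<integral>\<^sup>+x. ennreal (cmod (f x) powr enn2real p) \<partial>M)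
      \<le> (\<integral>\<^sup>+x. ennreal (cmod (g x) powr enn2real p) \<partial>M)"
    using le by (intro nn_integral_mono ennreal_leI powr_mono2) simp_all
  also have "\<dots> \<le> ennreal (K powr enn2real p)"
    using gK False Lp_enorm_le_iff[OF g p K] by simp
  finally show ?thesis using False Lp_enorm_le_iff[OF f p K] by simp
qed

lemma Lp_enorm_le_zero_iff:
  assumes f: "f \<in> borel_measurable M" and p: "0 < p"
  shows "Lp_enorm p M f \<le> ennreal 0 \<longleftrightarrow> (AE x in M. f x = 0)"
proof (cases "p = \<infinity>")
  case True
  then show ?thesis using Lp_enorm_le_iff[OF f p order_refl] by simp
next
  case False
  have "(\<integral>\<^sup>+x. ennreal (cmod (f x) powr enn2real p) \<partial>M) = 0 \<longleftrightarrow>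
      (AE x in M. ennreal (cmod (f x) powr enn2real p) = 0)"
    using f by (intro nn_integral_0_iff_AE) measurable
  then show ?thesis
    using False Lp_enorm_le_iff[OF f p order_refl] by (simp add: ennreal_eq_0_iff)
qed

lemma Lp_funs_bounded_on_finite_measure:
  assumes f: "f \<in> borel_measurable M" and p: "0 < p" and C: "0 \<le> C"
    and A: "A \<in> sets M" "emeasure M A < \<infinity>"
    and le: "\<And>x. x \<in> A \<Longrightarrow> cmod (f x) \<le> C"
  shows "(\<lambda>x. indicator A x * f x) \<in> Lp_funs p M"
proof -
  let ?u = "\<lambda>x. indicator A x * f x"
  have u: "?u \<in> borel_measurable M" using f A by measurable
  have "\<exists>K\<ge>0. Lp_enorm p M ?u \<le> ennreal K"
  proof (cases "p = \<infinity>")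
    case True
    have "AE x in M. cmod (?u x) \<le> C"
      using le C by (intro AE_I2) (simp add: indicator_def)
    then show ?thesis using C True Lp_enorm_le_iff[OF u p C] by auto
  next
    case False
    define r where "r = enn2real p"
    have r: "0 < r" using p False by (simp add: r_def enn2real_positive_iff less_top)
    have "(\<integral>\<^sup>+x. ennreal (cmod (?u x) powr r) \<partial>M)
        \<le> (\<integral>\<^sup>+x. ennreal (C powr r) * indicator A x \<partial>M)"
      using le r by (intro nn_integral_mono) (auto simp: indicator_def intro!: ennreal_leI powr_mono2)
    also have "\<dots> = ennreal (C powr r) * emeasure M A"
      using A by (simp add: nn_integral_cmult_indicator)
    also have "\<dots> < \<infinity>" using A by (simp add: ennreal_mult_less_top)
    finally obtain i where i: "(\<integral>\<^sup>+x. ennreal (cmod (?u x) powr r) \<partial>M) = ennreal i" "0 \<le> i"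
      by (cases "\<integral>\<^sup>+x. ennreal (cmod (?u x) powr r) \<partial>M") auto
    have "(i powr (1 / r)) powr r = i" using r i by (simp add: powr_powr)
    then have "Lp_enorm p M ?u \<le> ennreal (i powr (1 / r))"
      using False i Lp_enorm_le_iff[OF u p, of "i powr (1 / r)"] by (simp add: r_def)
    then show ?thesis by (intro exI[of _ "i powr (1 / r)"]) simp
  qed
  then show ?thesis
    using u le_less_trans[OF _ ennreal_less_top] by (auto simp: Lp_funs_def)
qed

text \<open>Monotone convergence for the norm: for \<open>p = \<infinity>\<close> countably many null sets are discarded, for
  finite \<open>p\<close> the integrals of \<open>\<bar>f\<bar>\<^sup>p\<close> over the sets increase to the full integral.\<close>

lemma Lp_enorm_le_exhaustion:
  assumes f: "f \<in> borel_measurable M" and p: "0 < p" and K: "0 \<le> K"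
    and E: "\<And>n::nat. E n \<in> sets M" "incseq E" "(\<Union>n. E n) = space M"
    and le: "\<And>n. Lp_enorm p M (\<lambda>x. indicator (E n) x * f x) \<le> ennreal K"
  shows "Lp_enorm p M f \<le> ennreal K"
proof -
  have u: "(\<lambda>x. indicator (E n) x * f x) \<in> borel_measurable M" for n
    using f E by measurable
  show ?thesis
  proof (cases "p = \<infinity>")
    case True
    have "\<forall>n. AE x in M. cmod (indicator (E n) x * f x) \<le> K"
      using le True Lp_enorm_le_iff[OF u p K] by simp
    then have "AE x in M. \<forall>n. cmod (indicator (E n) x * f x) \<le> K"
      by (simp add: AE_all_countable)
    then have "AE x in M. cmod (f x) \<le> K"
      using AE_space
    proof eventually_elim
      case (elim x)
      then obtain n where "x \<in> E n" using E by blast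
      then show ?case using elim(1)[rule_format, of n] by simp
    qed
    then show ?thesis using True Lp_enorm_le_iff[OF f p K] by simp
  next
    case False
    define r where "r = enn2real p"
    let ?F = "\<lambda>n x. ennreal (cmod (indicator (E n) x * f x) powr r)"
    have F: "?F n x = ennreal (cmod (f x) powr r) * indicator (E n) x" for n x
      by (simp add: indicator_def)
    have "ennreal (cmod (f x) powr r) = (SUP n. ?F n x)" if x: "x \<in> space M" for x
    proof (rule antisym)
      obtain n where "x \<in> E n" using x E by blast
      then show "ennreal (cmod (f x) powr r) \<le> (SUP n. ?F n x)"
        by (intro SUP_upper2[of n]) simp_all
      show "(SUP n. ?F n x) \<le> ennreal (cmod (f x) powr r)"
        by (rule SUP_least) (simp add: indicator_def)
    qed
    then have "(\<integral>\<^sup>+x. ennreal (cmod (f x) powr r) \<partial>M) = (\<integral>\<^sup>+x. (SUP n. ?F n x) \<partial>M)"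
      by (intro nn_integral_cong)
    also have "\<dots> = (SUP n. \<integral>\<^sup>+x. ?F n x \<partial>M)"
    proof (rule nn_integral_monotone_convergence_SUP)
      show "incseq ?F"
        unfolding F using E(2) by (auto simp: incseq_def le_fun_def indicator_def)
      show "\<And>n. ?F n \<in> borel_measurable M"
        using u by measurable
    qed
    also have "\<dots> \<le> ennreal (K powr r)"
      using le False Lp_enorm_le_iff[OF u p K] by (intro SUP_least) (simp add: r_def)
    finally show ?thesis using False Lp_enorm_le_iff[OF f p K] by (simp add: r_def)
  qed
qed

section \<open>Lower and upper bounds for multiplication\<close>

text \<open>The sets \<open>E\<^sub>n\<close> are chosen so that the restrictions of \<open>f\<close> lie in \<open>L\<^sub>p\<close>, where the bound is
  assumed; its right-hand side stays below \<open>K\<close> because \<open>\<bar>g \<chi>\<^sub>E f\<bar> \<le> \<bar>g f\<bar>\<close>.\<close>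

lemma lower_bound_extends:
  assumes M: "sigma_finite_measure M" and sets: "sets N = sets M"
    and p: "0 < p" and q: "0 < q" and c: "0 < c" and K: "0 \<le> K"
    and g: "g \<in> borel_measurable M" and f: "f \<in> borel_measurable M"
    and bound: "\<And>u. u \<in> Lp_funs p M \<Longrightarrow>
      c * enn2real (Lp_enorm p M u) \<le> enn2real (Lp_enorm q N (\<lambda>x. g x * u x))"
    and gf: "Lp_enorm q N (\<lambda>x. g x * f x) \<le> ennreal K"
  shows "Lp_enorm p M f \<le> ennreal (K / c)"
proof -
  interpret sigma_finite_measure M by (rule M)
  note [measurable] = f g
  have [measurable_cong]: "sets N = sets M" by (rule sets)
  obtain A :: "nat \<Rightarrow> 'a set" where A: "range A \<subseteq> sets M" "(\<Union>i. A i) = space M"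
      "\<And>i. emeasure M (A i) \<noteq> \<infinity>" "incseq A"
    using sigma_finite_incseq by blast
  define E where "E n = A n \<inter> {x \<in> space M. cmod (f x) \<le> real n}" for n
  have [measurable]: "A n \<in> sets M" for n using A(1) by blast
  have E_sets [measurable]: "E n \<in> sets M" for n unfolding E_def by measurable
  have E_fin: "emeasure M (E n) < \<infinity>" for n
  proof -
    have "emeasure M (E n) \<le> emeasure M (A n)"
      by (rule emeasure_mono) (auto simp: E_def)
    then show ?thesis using A(3)[of n] by (simp add: less_top le_less_trans)
  qed
  have E_inc: "incseq E"
    using A(4) by (fastforce simp: E_def incseq_def)
  have E_Un: "(\<Union>n. E n) = space M"
  proof
    show "(\<Union>n. E n) \<subseteq> space M" by (auto simp: E_def)
    show "space M \<subseteq> (\<Union>n. E n)"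
    proof
      fix x assume x: "x \<in> space M"
      then obtain i where i: "x \<in> A i" using A(2) by blast
      obtain j where j: "cmod (f x) \<le> real j" using real_arch_simple by blast
      have "x \<in> A (max i j)" using i A(4) by (meson incseqD max.cobounded1 subsetD)
      then have "x \<in> E (max i j)" using x j by (simp add: E_def)
      then show "x \<in> (\<Union>n. E n)" by blast
    qed
  qed
  show ?thesis
  proof (rule Lp_enorm_le_exhaustion[OF f p _ E_sets E_inc E_Un])
    show "0 \<le> K / c" using K c by simp
    fix n
    let ?u = "\<lambda>x. indicator (E n) x * f x"
    have u: "?u \<in> Lp_funs p M"
      by (rule Lp_funs_bounded_on_finite_measure[OF f p, of "real n"])
        (use E_fin in \<open>simp_all add: E_def\<close>)
    have "Lp_enorm q N (\<lambda>x. g x * ?u x) \<le> ennreal K"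
    proof (rule Lp_enorm_le_mono[OF _ _ q K _ gf])
      show "cmod (g x * (indicator (E n) x * f x)) \<le> cmod (g x * f x)" for x
        by (simp add: indicator_def)
    qed measurable
    then have "enn2real (Lp_enorm q N (\<lambda>x. g x * ?u x)) \<le> K"
      by (rule enn2real_leI[OF K])
    then have "enn2real (Lp_enorm p M ?u) \<le> K / c"
      using bound[OF u] c by (simp add: pos_le_divide_eq mult.commute)
    moreover have "Lp_enorm p M ?u = ennreal (enn2real (Lp_enorm p M ?u))"
      using u by (simp add: Lp_funs_def)
    ultimately show "Lp_enorm p M ?u \<le> ennreal (K / c)"
      using ennreal_leI by metis
  qed
qed

text \<open>If null sets of \<open>N\<close> are null for \<open>M\<close>, the formula for the operator holds on the classes of all
  measurable functions. Linearity can then be read off from representatives, without a separate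
  proof that \<open>L\<^sub>p\<close> is closed under addition.\<close>

lemma mult_op_class_absolutely_continuous:
  assumes ac: "absolutely_continuous N M" and sets: "sets N = sets M"
    and h: "h \<in> borel_measurable M" and u: "u \<in> borel_measurable N"
  shows "mult_op M h (ae_class N u) = ae_class M (\<lambda>x. h x * u x)"
proof -
  have "ae_class M (\<lambda>x. h x * v x) = ae_class M (\<lambda>x. h x * u x)" if v: "v \<in> ae_class N u" for v
  proof -
    note [measurable] = h
    have [measurable]: "u \<in> borel_measurable M" "v \<in> borel_measurable M"
      using u v measurable_cong_sets[OF sets refl] by (auto simp: mem_ae_class)
    have "AE x in N. u x = v x" using v by (simp add: mem_ae_class)
    then have "AE x in M. u x = v x"
      by (rule absolutely_continuous_AE[OF sets[symmetric] ac])
    then have "AE x in M. h x * v x = h x * u x" by eventually_elim simp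
    then show ?thesis by (subst ae_class_eq_iff) simp_all
  qed
  then show ?thesis using ae_class_self[OF u] unfolding mult_op_def by blast
qed

text \<open>Comparing norms with real numbers \<open>K\<close> lets the bound carry finiteness as well: that products with
  \<open>h\<close> land in \<open>L\<^sub>p\<close> is a consequence of the estimate.\<close>

lemma mult_op_bounded:
  assumes ac: "absolutely_continuous N M" and sets: "sets N = sets M"
    and h: "h \<in> borel_measurable M"
    and bound: "\<And>u K. u \<in> borel_measurable N \<Longrightarrow> 0 \<le> K \<Longrightarrow> Lp_enorm q N u \<le> ennreal K \<Longrightarrow>
      Lp_enorm p M (\<lambda>x. h x * u x) \<le> ennreal (C * K)"
    and C: "0 \<le> C"
  shows "mult_op_well_defined q N p M h" and "mult_op M h \<in> bounded_ops (Lp q N) (Lp p M)"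
proof -
  note [measurable] = h
  have [measurable_cong]: "sets N = sets M" by (rule sets)
  have le: "Lp_enorm p M (\<lambda>x. h x * u x) \<le> ennreal (C * enn2real (Lp_enorm q N u))"
    if "u \<in> Lp_funs q N" for u
    using that by (intro bound) (simp_all add: Lp_funs_def)
  have into: "(\<lambda>x. h x * u x) \<in> Lp_funs p M" if u: "u \<in> Lp_funs q N" for u
  proof -
    have [measurable]: "u \<in> borel_measurable N" using u by (simp add: Lp_funs_def)
    have "(\<lambda>x. h x * u x) \<in> borel_measurable M" by measurable
    then show ?thesis using le_less_trans[OF le[OF u] ennreal_less_top] by (simp add: Lp_funs_def)
  qed
  show "mult_op_well_defined q N p M h"
    unfolding mult_op_well_defined_def
  proof (intro conjI ballI impI)
    fix u v :: "'a \<Rightarrow> complex" assume "AE x in N. u x = v x"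
    then have "AE x in M. u x = v x"
      by (rule absolutely_continuous_AE[OF sets[symmetric] ac])
    then show "AE x in M. h x * u x = h x * v x" by eventually_elim simp
  qed (rule into)
  note cls = mult_op_class_absolutely_continuous[OF ac sets h]
  show "mult_op M h \<in> bounded_ops (Lp q N) (Lp p M)"
    unfolding bounded_ops_def mem_Collect_eq
  proof (intro conjI ballI allI exI[of _ C])
    fix F assume "F \<in> vcarrier (Lp q N)"
    then obtain u where u: "u \<in> Lp_funs q N" and F: "F = ae_class N u"
      by (auto simp: Lp_carrier)
    have um [measurable]: "u \<in> borel_measurable N" using u by (simp add: Lp_funs_def)
    show "mult_op M h F \<in> vcarrier (Lp p M)"
      using into[OF u] by (auto simp: F cls Lp_carrier)
    have "vnorm (Lp p M) (mult_op M h F) = enn2real (Lp_enorm p M (\<lambda>x. h x * u x))"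
      by (simp add: F cls Lp_norm_class)
    also have "\<dots> \<le> C * enn2real (Lp_enorm q N u)"
      using le[OF u] C by (intro enn2real_leI) simp_all
    also have "\<dots> = C * vnorm (Lp q N) F"
      by (simp add: F Lp_norm_class)
    finally show "vnorm (Lp p M) (mult_op M h F) \<le> C * vnorm (Lp q N) F" .
    fix a
    show "mult_op M h (vscale (Lp q N) a F) = vscale (Lp p M) a (mult_op M h F)"
      by (simp add: F cls Lp_scale_class mult.left_commute)
  next
    fix F G assume "F \<in> vcarrier (Lp q N)" "G \<in> vcarrier (Lp q N)"
    then obtain u v where F: "F = ae_class N u" and G: "G = ae_class N v"
      and um [measurable]: "u \<in> borel_measurable N" and vm [measurable]: "v \<in> borel_measurable N"
      by (auto simp: Lp_carrier Lp_funs_def)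
    show "mult_op M h (vadd (Lp q N) F G) = vadd (Lp p M) (mult_op M h F) (mult_op M h G)"
      by (simp add: F G cls Lp_add_class distrib_left)
  qed
qed

section \<open>One-sided inverses\<close>

lemma topologically_injective_if_left_inverse:
  assumes S: "S \<in> bounded_ops Y X"
    and T: "\<And>x. x \<in> vcarrier X \<Longrightarrow> T x \<in> vcarrier Y"
    and inv: "\<And>x. x \<in> vcarrier X \<Longrightarrow> S (T x) = x"
    and nonneg: "\<And>y. y \<in> vcarrier Y \<Longrightarrow> 0 \<le> vnorm Y y"
  shows "topologically_injective X Y T"
proof -
  obtain C where C: "\<forall>y\<in>vcarrier Y. vnorm X (S y) \<le> C * vnorm Y y"
    using S unfolding bounded_ops_def by blast
  \<comment> \<open>The bound \<open>C\<close> may be zero or negative.\<close>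
  define D where "D = max C 1"
  have "vnorm Y (T x) \<ge> 1 / D * vnorm X x" if x: "x \<in> vcarrier X" for x
  proof -
    have "vnorm X x \<le> C * vnorm Y (T x)" using C T[OF x] inv[OF x] by force
    also have "\<dots> \<le> D * vnorm Y (T x)"
      using nonneg[OF T[OF x]] by (intro mult_right_mono) (simp_all add: D_def)
    finally show ?thesis by (simp add: D_def divide_le_eq mult.commute)
  qed
  then show ?thesis
    unfolding topologically_injective_def by (intro exI[of _ "1 / D"]) (simp add: D_def)
qed

lemma topologically_surjective_if_right_inverse:
  assumes T: "T \<in> bounded_ops X Y"
    and inv: "\<And>x. x \<in> vcarrier X \<Longrightarrow> S (T x) = x"
    and nonneg: "\<And>x. x \<in> vcarrier X \<Longrightarrow> 0 \<le> vnorm X x"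
  shows "topologically_surjective Y X S"
proof -
  obtain C where C: "\<forall>x\<in>vcarrier X. vnorm Y (T x) \<le> C * vnorm X x"
    and into: "\<forall>x\<in>vcarrier X. T x \<in> vcarrier Y"
    using T unfolding bounded_ops_def by blast
  define D where "D = max C 1"
  have "vnorm Y (T x) \<le> D * vnorm X x" if x: "x \<in> vcarrier X" for x
  proof -
    have "vnorm Y (T x) \<le> C * vnorm X x" using C x by blast
    also have "\<dots> \<le> D * vnorm X x"
      using nonneg[OF x] by (intro mult_right_mono) (simp_all add: D_def)
    finally show ?thesis .
  qed
  then show ?thesis
    using into inv unfolding topologically_surjective_def
    by (intro exI[of _ D]) (auto simp: D_def)
qed

lemma Lp_norm_nonneg: "F \<in> vcarrier (Lp p M) \<Longrightarrow> 0 \<le> vnorm (Lp p M) F"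
  by (auto simp: Lp_carrier Lp_funs_def Lp_norm_class)

section \<open>Topologically injective multiplication operators\<close>

theorem theorem2p1p8:
  fixes \<mu> \<nu> \<nu>s :: "'a measure" and p q :: ennreal
    and g :: "'a \<Rightarrow> complex" and \<rho> :: "'a \<Rightarrow> real" and \<Omega>s \<Omega>c :: "'a set"
  assumes "sigma_finite_measure \<mu>" and "sigma_finite_measure \<nu>" and "sets \<nu> = sets \<mu>"
    and "1 \<le> p" and "1 \<le> q"
    and "g \<in> borel_measurable \<mu>"
    and "mult_op_well_defined p \<mu> q \<nu> g"
    and "mult_op \<nu> g \<in> bounded_ops (Lp p \<mu>) (Lp q \<nu>)"
    and "lebesgue_decomposition \<mu> \<nu> \<rho> \<nu>s \<Omega>s"
    and "\<Omega>c = space \<mu> - \<Omega>s"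
  shows "topologically_injective (Lp p \<mu>) (Lp q \<nu>) (mult_op \<nu> g) \<longleftrightarrow>
    (mult_op_well_defined q \<nu> p \<mu> (\<lambda>x. indicator \<Omega>c x / g x) \<and>
     mult_op \<mu> (\<lambda>x. indicator \<Omega>c x / g x) \<in> bounded_ops (Lp q \<nu>) (Lp p \<mu>) \<and>
     (\<forall>F\<in>vcarrier (Lp p \<mu>). mult_op \<mu> (\<lambda>x. indicator \<Omega>c x / g x) (mult_op \<nu> g F) = F) \<and>
     topologically_surjective (Lp q \<nu>) (Lp p \<mu>) (mult_op \<mu> (\<lambda>x. indicator \<Omega>c x / g x)))"
proof -
  define h :: "'a \<Rightarrow> complex" where "h = (\<lambda>x. indicator \<Omega>c x / g x)"
  note M = assms(1) and sets = assms(3) and wd = assms(7) and bdd = assms(8)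
  have p: "0 < p" and q: "0 < q" using assms(4,5) by (auto intro: less_le_trans[OF zero_less_one])
  note [measurable] = assms(6)
  have [measurable_cong]: "sets \<nu> = sets \<mu>" by (rule sets)
  have \<Omega>s [measurable]: "\<Omega>s \<in> sets \<mu>" and null: "emeasure \<mu> \<Omega>s = 0"
    using assms(9) by (simp_all add: lebesgue_decomposition_def)
  have [measurable]: "\<Omega>c \<in> sets \<mu>" using \<Omega>s assms(10) by simp
  have h [measurable]: "h \<in> borel_measurable \<mu>" unfolding h_def by measurable
  have "topologically_injective (Lp p \<mu>) (Lp q \<nu>) (mult_op \<nu> g) \<longleftrightarrow>
    (mult_op_well_defined q \<nu> p \<mu> h \<and>
     mult_op \<mu> h \<in> bounded_ops (Lp q \<nu>) (Lp p \<mu>) \<and>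
     (\<forall>F\<in>vcarrier (Lp p \<mu>). mult_op \<mu> h (mult_op \<nu> g F) = F) \<and>
     topologically_surjective (Lp q \<nu>) (Lp p \<mu>) (mult_op \<mu> h))" (is "?inj \<longleftrightarrow> ?inv")
  proof
    assume ?inv
    then show ?inj
      using bdd Lp_norm_nonneg
      by (intro topologically_injective_if_left_inverse[where S = "mult_op \<mu> h"])
        (auto simp: bounded_ops_def)
  next
    assume ?inj
    then obtain c where c: "0 < c" and low: "\<forall>F\<in>vcarrier (Lp p \<mu>).
        vnorm (Lp q \<nu>) (mult_op \<nu> g F) \<ge> c * vnorm (Lp p \<mu>) F"
      unfolding topologically_injective_def by blast
    have "c * enn2real (Lp_enorm p \<mu> u) \<le> enn2real (Lp_enorm q \<nu> (\<lambda>x. g x * u x))"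
      if u: "u \<in> Lp_funs p \<mu>" for u
    proof -
      have [measurable]: "u \<in> borel_measurable \<mu>" using u by (simp add: Lp_funs_def)
      have "ae_class \<mu> u \<in> vcarrier (Lp p \<mu>)" using u by (simp add: Lp_carrier)
      then show ?thesis
        using low by (force simp: mult_op_class[OF wd u] Lp_norm_class)
    qed
    note ext = lower_bound_extends[OF M sets p q c _ assms(6) _ this]
    have vanish: "AE x in \<mu>. x \<notin> A"
      if A [measurable]: "A \<in> sets \<mu>" and gA: "AE x in \<nu>. g x * indicator A x = 0" for A
    proof -
      have "Lp_enorm q \<nu> (\<lambda>x. g x * indicator A x) \<le> ennreal 0"
        using gA by (subst Lp_enorm_le_zero_iff[OF _ q]) measurable
      then have "Lp_enorm p \<mu> (indicator A) \<le> ennreal (0 / c)"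
        by (intro ext) simp_all
      then have "AE x in \<mu>. indicator A x = (0 :: complex)"
        using Lp_enorm_le_zero_iff[OF _ p, of "indicator A" \<mu>] by simp
      then show ?thesis by eventually_elim (simp add: indicator_def split: if_splits)
    qed
    have ac: "absolutely_continuous \<nu> \<mu>"
      unfolding absolutely_continuous_def
    proof
      fix A assume A: "A \<in> null_sets \<nu>"
      then have As: "A \<in> sets \<mu>" using sets by auto
      have "AE x in \<nu>. g x * indicator A x = 0"
        using AE_not_in[OF A] by eventually_elim simp
      with As have "AE x in \<mu>. x \<notin> A" by (rule vanish)
      then show "A \<in> null_sets \<mu>" using As by (simp add: AE_iff_null_sets)
    qed
    have g0: "AE x in \<mu>. g x \<noteq> 0"
    proof -
      have "AE x in \<mu>. x \<notin> {x \<in> space \<mu>. g x = 0}"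
        by (rule vanish) (auto simp: indicator_def)
      then show ?thesis using AE_space by eventually_elim simp
    qed
    have "AE x in \<mu>. x \<notin> \<Omega>s" using null \<Omega>s by (intro AE_not_in) auto
    then have hg: "AE x in \<mu>. h x * g x = 1"
      using g0 AE_space by eventually_elim (simp add: h_def assms(10))
    have hb: "Lp_enorm p \<mu> (\<lambda>x. h x * u x) \<le> ennreal (1 / c * K)"
      if u [measurable]: "u \<in> borel_measurable \<nu>" and K: "0 \<le> K"
        and uK: "Lp_enorm q \<nu> u \<le> ennreal K" for u K
    proof -
      have [measurable]: "u \<in> borel_measurable \<mu>" using u by simp
      have "Lp_enorm q \<nu> (\<lambda>x. g x * (h x * u x)) \<le> ennreal K"
      proof (rule Lp_enorm_le_mono[OF _ u q K _ uK])
        show "cmod (g x * (h x * u x)) \<le> cmod (u x)" for x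
          by (cases "g x = 0") (simp_all add: h_def indicator_def)
      qed measurable
      then have "Lp_enorm p \<mu> (\<lambda>x. h x * u x) \<le> ennreal (K / c)"
        by (intro ext) (use K in simp_all)
      then show ?thesis by simp
    qed
    have h_wd: "mult_op_well_defined q \<nu> p \<mu> h"
      and h_bdd: "mult_op \<mu> h \<in> bounded_ops (Lp q \<nu>) (Lp p \<mu>)"
      using mult_op_bounded[OF ac sets h hb] c by simp_all
    have left: "mult_op \<mu> h (mult_op \<nu> g F) = F" if F_in: "F \<in> vcarrier (Lp p \<mu>)" for F
    proof -
      obtain u where u: "u \<in> Lp_funs p \<mu>" and F: "F = ae_class \<mu> u"
        using F_in by (auto simp: Lp_carrier)
      have um [measurable]: "u \<in> borel_measurable \<mu>" using u by (simp add: Lp_funs_def)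
      have "mult_op \<mu> h (mult_op \<nu> g F) = ae_class \<mu> (\<lambda>x. h x * (g x * u x))"
        unfolding F mult_op_class[OF wd u]
        by (rule mult_op_class_absolutely_continuous[OF ac sets h]) measurable
      also have "\<dots> = F"
        unfolding F using hg by (subst ae_class_eq_iff) (measurable, auto simp: mult.assoc[symmetric])
      finally show ?thesis .
    qed
    show ?inv
      using h_wd h_bdd left
        topologically_surjective_if_right_inverse[OF bdd left Lp_norm_nonneg]
      by blast
  qed
  then show ?thesis by (simp only: h_def)
qed

end
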